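(* Let $n \geq 2$ be an integer, let $N := n - \frac{1}{24}$, and let $k$ be a positive integer with $k \leq \frac{\sqrt{N}}{4}$. Then \[ \nu_k(n) - \nu_k(n-k) > 0. \]
   Context: For a positive integer $k$ and nonnegative integer $m$, $\nu_k(m)$ denotes the number of partitions of $m$ having no part equal to $k$ (non-$k$-ary partitions); equivalently $\nu_k(m) = p(m) - p(m-k)$, where $p$ is the partition function and $p(r)=0$ for $r<0$, $p(0)=1$. *)

theory Defs
  imports Complex_Main "HOL-Library.Multiset"
begin

definition partitions :: "nat \<Rightarrow> nat multiset set" where
  "partitions m = {M. 0 \<notin># M \<and> sum_mset M = m}"

definition nonkary :: "nat \<Rightarrow> nat \<Rightarrow> nat" where
  "nonkary k m = card {M \<in> partitions m. k \<notin># M}"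

text \<open>Finiteness guarantees that \<^const>\<open>card\<close> counts in the definition of \<^const>\<open>nonkary\<close>.\<close>

lemma finite_partitions: "finite (partitions m)"
proof (rule finite_subset)
  have size_le: "size M \<le> sum_mset M" if "0 \<notin># M" for M :: "nat multiset"
    using that by (induction M) auto
  have "set_mset M \<subseteq> {..m} \<and> size M \<le> m" if "M \<in> partitions m" for M
  proof
    show "size M \<le> m" using that size_le by (auto simp: partitions_def)
    show "set_mset M \<subseteq> {..m}"
    proof
      fix x assume "x \<in># M"
      then obtain B where "M = add_mset x B" by (blast dest: multi_member_split)
      then show "x \<in> {..m}" using that by (auto simp: partitions_def)
    qed
  qed
  then show "partitions m \<subseteq> mset ` {xs. set xs \<subseteq> {..m} \<and> length xs \<le> m}"
    by (metis (mono_tags, lifting) ex_mset imageI mem_Collect_eq set_mset_mset size_mset subsetI)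
  show "finite (mset ` {xs. set xs \<subseteq> {..m} \<and> length xs \<le> m})"
    by (intro finite_imageI finite_lists_length_le) simp
qed

lemma nonkary_eq_diff:
  assumes "k \<ge> 1"
  shows "int (nonkary k m) =
    int (card (partitions m)) - (if k \<le> m then int (card (partitions (m - k))) else 0)"
proof -
  have with_k: "{M \<in> partitions m. k \<in># M} = (if k \<le> m then add_mset k ` partitions (m - k) else {})"
  proof (intro set_eqI)
    fix M
    have "M \<in> add_mset k ` partitions (m - k)" "k \<le> m" if "M \<in> partitions m" "k \<in># M"
    proof -
      from that(2) obtain B where B: "M = add_mset k B" by (blast dest: multi_member_split)
      with that(1) have "B \<in> partitions (m - k)" "k \<le> m" by (auto simp: partitions_def)
      with B show "M \<in> add_mset k ` partitions (m - k)" "k \<le> m" by auto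
    qed
    moreover have "M \<in> partitions m \<and> k \<in># M"
      if "k \<le> m" "M \<in> add_mset k ` partitions (m - k)"
      using that assms by (auto simp: partitions_def)
    ultimately show "M \<in> {M \<in> partitions m. k \<in># M} \<longleftrightarrow>
        M \<in> (if k \<le> m then add_mset k ` partitions (m - k) else {})"
      by auto
  qed
  have "card (partitions m) = card ({M \<in> partitions m. k \<notin># M} \<union> {M \<in> partitions m. k \<in># M})"
    by (rule arg_cong[where f = card]) auto
  also have "\<dots> = nonkary k m + card {M \<in> partitions m. k \<in># M}"
    unfolding nonkary_def
    by (rule card_Un_disjoint) (auto simp: finite_partitions)
  also have "card {M \<in> partitions m. k \<in># M} = (if k \<le> m then card (partitions (m - k)) else 0)"
    unfolding with_k by (auto intro: card_image simp: inj_on_def)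
  finally show ?thesis by auto
qed

end

theory Submission
  imports Defs
begin

text \<open>
  Both cases rest on an injection that is not surjective, from the partitions of \<open>n - k\<close> without
  part \<open>k\<close> into those of \<open>n\<close>. For \<open>k \<ge> 2\<close> add \<open>k\<close> parts equal to \<open>1\<close>; this misses the partition
  with the single part \<open>n\<close>. For \<open>k = 1\<close> increase a largest part by one; this misses every
  partition whose largest part is repeated.
\<close>

lemma nonkary_less_if_inj:
  assumes "inj_on f {M \<in> partitions l. k \<notin># M}"
    and "f ` {M \<in> partitions l. k \<notin># M} \<subset> {M \<in> partitions m. k \<notin># M}"
  shows "nonkary k l < nonkary k m"
proof -
  have "nonkary k l = card (f ` {M \<in> partitions l. k \<notin># M})"
    unfolding nonkary_def using assms(1) by (simp add: card_image)
  also have "\<dots> < nonkary k m"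
    unfolding nonkary_def using assms(2) finite_partitions by (intro psubset_card_mono) auto
  finally show ?thesis .
qed

lemma nonkary_diff_less:
  assumes "2 \<le> k" "k < n"
  shows "nonkary k (n - k) < nonkary k n"
proof (rule nonkary_less_if_inj[where f = "\<lambda>M. M + replicate_mset k 1"])
  let ?f = "\<lambda>M::nat multiset. M + replicate_mset k 1"
  let ?A = "\<lambda>m. {M \<in> partitions m. k \<notin># M}"
  \<comment> \<open>Since k is at least 2, the added ones do not create a part k.\<close>
  have "?f ` ?A (n - k) \<subseteq> ?A n"
    using assms by (auto simp: partitions_def)
  moreover have "{#n#} \<in> ?A n"
    using assms by (auto simp: partitions_def)
  \<comment> \<open>Every image has at least k parts, hence at least two.\<close>
  moreover have "{#n#} \<notin> ?f ` ?A (n - k)"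
  proof
    assume "{#n#} \<in> ?f ` ?A (n - k)"
    then obtain M where "{#n#} = ?f M" by blast
    then have "size {#n#} = size (?f M)" by (rule arg_cong)
    then show False using assms by simp
  qed
  ultimately show "?f ` ?A (n - k) \<subset> ?A n" by blast
qed (auto simp: inj_on_def)

text \<open>The value \<open>Max_mset {#}\<close> is unspecified, so the lemmas below that relate
  the result to M as a partition assume M nonempty.\<close>

definition raise_max :: "nat multiset \<Rightarrow> nat multiset" where
  "raise_max M = add_mset (Suc (Max_mset M)) (M - {#Max_mset M#})"

lemma Max_raise_max: "Max_mset (raise_max M) = Suc (Max_mset M)"
proof (rule Max_eqI)
  fix y assume "y \<in># raise_max M"
  then consider "y = Suc (Max_mset M)" | "y \<in># M"
    by (auto simp: raise_max_def dest: in_diffD)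
  then show "y \<le> Suc (Max_mset M)"
    by cases (auto intro: le_SucI)
qed (auto simp: raise_max_def)

text \<open>The raised part exceeds every part of M, so no other copy of it exists. This keeps
  partitions with a repeated largest part out of the image.\<close>

lemma count_Max_raise_max: "count (raise_max M) (Max_mset (raise_max M)) = 1"
proof -
  have "Suc (Max_mset M) \<notin># M"
  proof
    assume "Suc (Max_mset M) \<in># M"
    then have "Suc (Max_mset M) \<le> Max_mset M" by (intro Max_ge) auto
    then show False by simp
  qed
  then show ?thesis
    unfolding Max_raise_max by (simp add: raise_max_def not_in_iff)
qed

text \<open>The raised part is recognizable as the largest one, so lowering it recovers M. This left
  inverse yields injectivity.\<close>

lemma raise_max_inverse:
  assumes "M \<noteq> {#}"
  shows "add_mset (Max_mset (raise_max M) - 1) (raise_max M - {#Max_mset (raise_max M)#}) = M"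
  unfolding Max_raise_max using assms by (simp add: raise_max_def)

lemma raise_max_in_partitions:
  assumes "M \<in> partitions m" "M \<noteq> {#}"
  shows "raise_max M \<in> partitions (Suc m)"
proof -
  have "add_mset (Max_mset M) (M - {#Max_mset M#}) = M" using assms(2) by simp
  then have "sum_mset M = Max_mset M + sum_mset (M - {#Max_mset M#})"
    by (metis sum_mset.add_mset)
  then show ?thesis
    using assms(1) by (auto simp: partitions_def raise_max_def dest: in_diffD)
qed

text \<open>The raised part is the successor of a positive number, hence at least 2.\<close>

lemma one_notin_raise_max:
  assumes "M \<in> partitions m" "M \<noteq> {#}" "1 \<notin># M"
  shows "1 \<notin># raise_max M"
proof -
  have "Max_mset M \<in># M" using assms(2) by simp
  then have "Max_mset M \<noteq> 0" using assms(1) by (metis (mono_tags, lifting) mem_Collect_eq partitions_def)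
  then show ?thesis using assms(3) by (auto simp: raise_max_def dest: in_diffD)
qed

lemma ex_partition_repeated_Max:
  assumes "n \<ge> 11"
  shows "\<exists>M \<in> partitions n. 1 \<notin># M \<and> count M (Max_mset M) = 2"
proof (cases "even n")
  case True
  then show ?thesis
    using assms by (intro bexI[of _ "{#n div 2, n div 2#}"]) (auto simp: partitions_def)
next
  case False
  \<comment> \<open>The part 3 corrects the parity. From n \<ge> 11 follows
    \<open>?a \<ge> 4\<close>, so 3 lies below the largest part, which then occurs exactly
    twice.\<close>
  let ?a = "(n - 3) div 2"
  have "?a \<ge> 4" "?a + (?a + 3) = n" using assms False by presburger+
  then show ?thesis
    by (intro bexI[of _ "{#?a, ?a, 3#}"]) (auto simp: partitions_def max_def)
qed

lemma nonkary_one_less: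
  assumes "n \<ge> 11"
  shows "nonkary 1 (n - 1) < nonkary 1 n"
proof (rule nonkary_less_if_inj[where f = raise_max])
  let ?A = "\<lambda>m. {M \<in> partitions m. 1 \<notin># M}"
  \<comment> \<open>The empty multiset sums to 0, whereas n - 1 is positive.\<close>
  have nonempty: "M \<noteq> {#}" if "M \<in> ?A (n - 1)" for M
    using that assms by (auto simp: partitions_def)
  show "inj_on raise_max (?A (n - 1))"
    by (rule inj_onI) (metis nonempty raise_max_inverse)
  have "raise_max ` ?A (n - 1) \<subseteq> ?A n"
  proof (rule image_subsetI)
    fix M assume M: "M \<in> ?A (n - 1)"
    have "Suc (n - 1) = n" using assms by simp
    then show "raise_max M \<in> ?A n"
      using M nonempty[OF M] raise_max_in_partitions[of M "n - 1"] one_notin_raise_max[of M "n - 1"]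
      by simp
  qed
  moreover obtain M where M: "M \<in> ?A n" "count M (Max_mset M) = 2"
    using ex_partition_repeated_Max[OF assms] by blast
  moreover have "M \<notin> raise_max ` ?A (n - 1)"
    using M(2) count_Max_raise_max by fastforce
  ultimately show "raise_max ` ?A (n - 1) \<subset> ?A n" by blast
qed

theorem theorem1p5:
  fixes n k :: nat and N :: real
  assumes "n \<ge> 2"
    and "N = real n - 1 / 24"
    and "k \<ge> 1"
    and "real k \<le> sqrt N / 4"
  shows "int (nonkary k n) - int (nonkary k (n - k)) > 0"
proof -
  have "4 * real k \<le> sqrt N" using assms(4) by simp
  then have "(4 * real k)\<^sup>2 \<le> N" by (intro sqrt_ge_absD) simp
  \<comment> \<open>The term 1/24 in N makes the inequality strict.\<close>
  then have "real (16 * k\<^sup>2) < real n" using assms(2) by (simp add: power_mult_distrib)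
  then have bound: "16 * k\<^sup>2 < n" by (simp only: of_nat_less_iff)
  \<comment> \<open>With the bound, the first fact gives k < n and the second gives n > 16, more
    than the case k = 1 requires.\<close>
  have "k \<le> k\<^sup>2" "1 \<le> k\<^sup>2" using assms(3) by (simp_all add: power2_eq_square)
  with bound have "k < n" "n \<ge> 11" by linarith+
  then have "nonkary k (n - k) < nonkary k n"
    using nonkary_diff_less[of k n] nonkary_one_less[of n] assms(3) by (cases "k = 1") auto
  then show ?thesis by simp
qed

end
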